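(* Let $M$ be a symmetric nonsingular $n\times n$ mass matrix, $V\colon\mathbb{R}^n\to\mathbb{R}$ a smooth potential, $g_i\colon\mathbb{R}^n\to\mathbb{R}^n$, $i=1,\dots,k$, be $k$ smooth functions, and let $q$ be a smooth extremal with fixed endpoints for the functional $$S(q)=\int_{t_0}^{t_1}L(t,q,\dot q)\,dt=\int_{t_0}^{t_1}\Big(\tfrac12\dot q^TM\dot q-V(q)\Big)dt$$ subject to the velocity constraints $g_i(q)\cdot\dot q=0$, $i=1,\dots,k$, and the holonomic constraints $h_i(q)=0$, $i=1,\dots,l$, where $h_i\colon\mathbb{R}^n\to\mathbb{R}$. Then $$J\dot z=\nabla H(z),$$ where $$J=\begin{pmatrix}0&-I_n&0&0\\ I_n&0&0&0\\ 0&0&0_{k\times k}&0\\ 0&0&0&0_{l\times l}\end{pmatrix},\qquad z=\begin{pmatrix} q \\ p \\ \lambda \\ \lambda^h \end{pmatrix},\qquad p=M\dot q-\sum_{i=1}^k\lambda_ig_i(q),$$ $$H(z)=\tfrac12\Big(p+\sum_{i=1}^k\lambda_ig_i(q)\Big)^TM^{-1}\Big(p+\sum_{i=1}^k\lambda_ig_i(q)\Big)+V(q)+\sum_{i=1}^l\lambda^h_ih_i(q),$$ and, furthermore, the Euler--Lagrange equations of the constrained problem are equivalent to the generalized Hamiltonian system $J\dot z=\nabla H(z)$. If, in addition, the velocity constraints are linearly independent for all $q$ (i.e. $g_1(q),\dots,g_k(q)$ are linearly independent for all $q$), then $J\dot z=\nabla H(z)$ is equivalent to a canonical holonomically constrained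 Hamiltonian system.
   Context: Here $\lambda=(\lambda_1,\dots,\lambda_k)$ and $\lambda^h=(\lambda^h_1,\dots,\lambda^h_l)$ are Lagrange multipliers (functions of $t$). The Euler--Lagrange equations of the constrained problem are, with $$F(q,\dot q,\lambda,\lambda^h)=\tfrac12\dot q^TM\dot q-V(q)-\sum_{i=1}^k\lambda_ig_i(q)\cdot\dot q-\sum_{i=1}^l\lambda^h_ih_i(q),$$ the equations $$\frac{d}{dt}\big(\nabla_{\dot q}F\big)-\nabla_qF=0,\qquad g_i(q)\cdot\dot q=0\ (1\le i\le k),\qquad h_i(q)=0\ (1\le i\le l).$$ A smooth extremal is a smooth curve $q(t)$ satisfying these equations for some multipliers $\lambda(t),\lambda^h(t)$. A canonical holonomically constrained Hamiltonian system is one of the form $$\dot q=\tilde H_p(q,p),\qquad\dot p=-\tilde H_q(q,p)-\sum_{i=1}^l\lambda^h_i\nabla h_i(q),\qquad h_i(q)=0\ (1\le i\le l),$$ for some function $\tilde H\colon\mathbb{R}^n\times\mathbb{R}^n\to\mathbb{R}$. In the last assertion, equivalence means that solutions of the two systems correspond, with the same $q,p,\lambda^h$, the multipliers $\lambda$ being eliminated.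
   Formalization: In the last assertion it is also assumed that M^{-1} is nondegenerate on span{g_1(q),...,g_k(q)} for all q (automatic for positive definite M); without it the claim fails, e.g. M=diag(1,-1), g=(1,1), V=0. The h_i are assumed differentiable. *)

theory Defs
  imports "HOL-Analysis.Analysis"
begin

(* C^r for functions of finitely many real variables. Only meant for sets on which the derivative
   within S is unique, such as UNIV or {a..b} with a < b. *)
primrec Cr_on :: "nat \<Rightarrow> 'a::euclidean_space set \<Rightarrow> ('a \<Rightarrow> 'b::euclidean_space) \<Rightarrow> bool" where
  "Cr_on 0 S f \<longleftrightarrow> continuous_on S f"
| "Cr_on (Suc r) S f \<longleftrightarrow>
     f differentiable_on S \<and> (\<forall>v. Cr_on r S (\<lambda>x. frechet_derivative f (at x within S) v))"

definition smooth_on :: "'a::euclidean_space set \<Rightarrow> ('a \<Rightarrow> 'b::euclidean_space) \<Rightarrow> bool" where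
  "smooth_on S f \<longleftrightarrow> (\<forall>r. Cr_on r S f)"

definition grad :: "('a::real_inner \<Rightarrow> real) \<Rightarrow> 'a \<Rightarrow> 'a" where
  "grad f x = (THE D. GDERIV f x :> D)"

definition lagrangian :: "real^'n^'n \<Rightarrow> (real^'n \<Rightarrow> real) \<Rightarrow> real^'n \<Rightarrow> real^'n \<Rightarrow> real" where
  "lagrangian M V x v = 1/2 * (v \<bullet> (M *v v)) - V x"

(* The constraints are indexed by sets K and L of elements of the finite types 'k and 'l, so that
   there may be none of either kind (types are nonempty). For K = UNIV and L = UNIV the numbers of
   constraints are CARD('k) and CARD('l). In general the coordinates of the multipliers outside
   K and L do not occur in any equation. *)
definition constrained_lagrangian ::
  "real^'n^'n \<Rightarrow> (real^'n \<Rightarrow> real) \<Rightarrow> 'k::finite set \<Rightarrow> ('k \<Rightarrow> real^'n \<Rightarrow> real^'n) \<Rightarrow>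
   'l::finite set \<Rightarrow> ('l \<Rightarrow> real^'n \<Rightarrow> real) \<Rightarrow>
   real^'n \<Rightarrow> real^'n \<Rightarrow> real^'k \<Rightarrow> real^'l \<Rightarrow> real" where
  "constrained_lagrangian M V K g L h x v lam mu =
     lagrangian M V x v - (\<Sum>i\<in>K. lam $ i * (g i x \<bullet> v)) - (\<Sum>i\<in>L. mu $ i * h i x)"

(* T is a time interval; derivatives at its endpoints are one-sided. The multipliers are required
   to be differentiable because their derivatives occur in the generalized Hamiltonian system. *)
definition euler_lagrange ::
  "real^'n^'n \<Rightarrow> (real^'n \<Rightarrow> real) \<Rightarrow> 'k::finite set \<Rightarrow> ('k \<Rightarrow> real^'n \<Rightarrow> real^'n) \<Rightarrow>
   'l::finite set \<Rightarrow> ('l \<Rightarrow> real^'n \<Rightarrow> real) \<Rightarrow> real set \<Rightarrow>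
   (real \<Rightarrow> real^'n) \<Rightarrow> (real \<Rightarrow> real^'k) \<Rightarrow> (real \<Rightarrow> real^'l) \<Rightarrow> bool" where
  "euler_lagrange M V K g L h T q lam mu \<longleftrightarrow>
     (let F = constrained_lagrangian M V K g L h;
          q' = (\<lambda>t. vector_derivative q (at t within T));
          Fv = (\<lambda>t. grad (\<lambda>v. F (q t) v (lam t) (mu t)) (q' t));
          Fx = (\<lambda>t. grad (\<lambda>x. F x (q' t) (lam t) (mu t)) (q t))
      in q differentiable_on T \<and> lam differentiable_on T \<and> mu differentiable_on T \<and>
         Fv differentiable_on T \<and>
         (\<forall>t\<in>T. vector_derivative Fv (at t within T) - Fx t = 0 \<and>
                (\<forall>i\<in>K. g i (q t) \<bullet> q' t = 0) \<and>
                (\<forall>i\<in>L. h i (q t) = 0)))"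

definition smooth_extremal ::
  "real^'n^'n \<Rightarrow> (real^'n \<Rightarrow> real) \<Rightarrow> 'k::finite set \<Rightarrow> ('k \<Rightarrow> real^'n \<Rightarrow> real^'n) \<Rightarrow>
   'l::finite set \<Rightarrow> ('l \<Rightarrow> real^'n \<Rightarrow> real) \<Rightarrow> real \<Rightarrow> real \<Rightarrow> real^'n \<Rightarrow> real^'n \<Rightarrow>
   (real \<Rightarrow> real^'n) \<Rightarrow> bool" where
  "smooth_extremal M V K g L h t0 t1 q0 q1 q \<longleftrightarrow>
     smooth_on {t0..t1} q \<and> q t0 = q0 \<and> q t1 = q1 \<and>
     (\<exists>(lam :: real \<Rightarrow> real^'k) (mu :: real \<Rightarrow> real^'l).
        euler_lagrange M V K g L h {t0..t1} q lam mu)"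

definition momentum ::
  "real^'n^'n \<Rightarrow> 'k::finite set \<Rightarrow> ('k \<Rightarrow> real^'n \<Rightarrow> real^'n) \<Rightarrow> real set \<Rightarrow>
   (real \<Rightarrow> real^'n) \<Rightarrow> (real \<Rightarrow> real^'k) \<Rightarrow> real \<Rightarrow> real^'n" where
  "momentum M K g T q lam t =
     M *v vector_derivative q (at t within T) - (\<Sum>i\<in>K. lam t $ i *\<^sub>R g i (q t))"

type_synonym ('n, 'k, 'l) phase = "real^('n + 'n + 'k + 'l)"

definition phase_point ::
  "real^'n \<Rightarrow> real^'n \<Rightarrow> real^'k \<Rightarrow> real^'l \<Rightarrow> ('n, 'k, 'l) phase" where
  "phase_point x p lam mu =
     (\<chi> i. case i of Inl a \<Rightarrow> x $ a | Inr (Inl a) \<Rightarrow> p $ a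
                   | Inr (Inr (Inl b)) \<Rightarrow> lam $ b | Inr (Inr (Inr c)) \<Rightarrow> mu $ c)"

definition gen_J ::
  "real^('n::finite + 'n + 'k::finite + 'l::finite)^('n + 'n + 'k + 'l)" where
  "gen_J = (\<chi> i j. case (i, j) of
       (Inl a, Inr (Inl b)) \<Rightarrow> (if a = b then - 1 else 0)
     | (Inr (Inl a), Inl b) \<Rightarrow> (if a = b then 1 else 0)
     | _ \<Rightarrow> 0)"

definition gen_hamiltonian ::
  "real^'n^'n \<Rightarrow> (real^'n \<Rightarrow> real) \<Rightarrow> 'k::finite set \<Rightarrow> ('k \<Rightarrow> real^'n \<Rightarrow> real^'n) \<Rightarrow>
   'l::finite set \<Rightarrow> ('l \<Rightarrow> real^'n \<Rightarrow> real) \<Rightarrow> ('n, 'k, 'l) phase \<Rightarrow> real" where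
  "gen_hamiltonian M V K g L h z =
     (let x = (\<chi> a. z $ Inl a);
          p = (\<chi> a. z $ Inr (Inl a));
          lam = (\<chi> b. z $ Inr (Inr (Inl b)));
          mu = (\<chi> c. z $ Inr (Inr (Inr c)));
          w = p + (\<Sum>i\<in>K. lam $ i *\<^sub>R g i x)
      in 1/2 * (w \<bullet> (matrix_inv M *v w)) + V x + (\<Sum>i\<in>L. mu $ i * h i x))"

definition gen_ham_system ::
  "real^'n^'n \<Rightarrow> (real^'n \<Rightarrow> real) \<Rightarrow> 'k::finite set \<Rightarrow> ('k \<Rightarrow> real^'n \<Rightarrow> real^'n) \<Rightarrow>
   'l::finite set \<Rightarrow> ('l \<Rightarrow> real^'n \<Rightarrow> real) \<Rightarrow> real set \<Rightarrow>
   (real \<Rightarrow> ('n, 'k, 'l) phase) \<Rightarrow> bool" where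
  "gen_ham_system M V K g L h T z \<longleftrightarrow>
     z differentiable_on T \<and>
     (\<forall>t\<in>T. gen_J *v vector_derivative z (at t within T)
             = grad (gen_hamiltonian M V K g L h) (z t))"

definition canonical_system ::
  "((real^'n) \<times> (real^'n) \<Rightarrow> real) \<Rightarrow> 'l::finite set \<Rightarrow> ('l \<Rightarrow> real^'n \<Rightarrow> real) \<Rightarrow> real set \<Rightarrow>
   (real \<Rightarrow> real^'n) \<Rightarrow> (real \<Rightarrow> real^'n) \<Rightarrow> (real \<Rightarrow> real^'l) \<Rightarrow> bool" where
  "canonical_system Ht L h T q p mu \<longleftrightarrow>
     q differentiable_on T \<and> p differentiable_on T \<and> mu differentiable_on T \<and>
     (\<forall>t\<in>T. vector_derivative q (at t within T) = grad (\<lambda>y. Ht (q t, y)) (p t) \<and>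
            vector_derivative p (at t within T)
              = - grad (\<lambda>x. Ht (x, p t)) (q t) - (\<Sum>i\<in>L. mu t $ i *\<^sub>R grad (h i) (q t)) \<and>
            (\<forall>i\<in>L. h i (q t) = 0))"

definition lin_indep_family :: "'k set \<Rightarrow> ('k \<Rightarrow> 'v::real_vector) \<Rightarrow> bool" where
  "lin_indep_family K u \<longleftrightarrow> inj_on u K \<and> independent (u ` K)"

definition nondegenerate_on :: "real^'n^'n \<Rightarrow> (real^'n) set \<Rightarrow> bool" where
  "nondegenerate_on A W \<longleftrightarrow> (\<forall>u\<in>W. (\<forall>w\<in>W. w \<bullet> (A *v u) = 0) \<longrightarrow> u = 0)"

(* Automatic for a positive definite mass matrix. For an indefinite M the inverse may degenerate
   on the span of the constraint vectors: M = diag(1,-1) and the single vector (1,1). *)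
lemma nondegenerate_on_matrix_inv_if_pos_def:
  fixes M :: "real^'n^'n"
  assumes "invertible M" and pos: "\<And>x. x \<noteq> 0 \<Longrightarrow> x \<bullet> (M *v x) > 0"
  shows "nondegenerate_on (matrix_inv M) W"
  unfolding nondegenerate_on_def
proof (intro ballI impI)
  fix u assume "u \<in> W" and "\<forall>w\<in>W. w \<bullet> (matrix_inv M *v u) = 0"
  then have z: "u \<bullet> (matrix_inv M *v u) = 0" by blast
  define y where "y = matrix_inv M *v u"
  have "M ** matrix_inv M = mat 1"
    using assms(1) unfolding invertible_def matrix_inv_def by (rule someI2_ex) simp
  then have u: "u = M *v y"
    unfolding y_def by (simp add: matrix_vector_mul_assoc)
  have "y \<bullet> (M *v y) = 0"
    using z unfolding y_def[symmetric] u[symmetric] by (simp add: inner_commute)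
  then have "y = 0" using pos[of y] by force
  then show "u = 0" by (subst u) simp
qed

end

theory Submission
  imports Defs
begin

text \<open>
The passage from the Euler-Lagrange equations to the generalized Hamiltonian system is the
Legendre transformation. Write \<open>v = M\<inverse>(p + \<Sum>\<^sub>i \<lambda>\<^sub>i g\<^sub>i(q))\<close> for the velocity that belongs to a point
of the generalized phase space. The \<open>p\<close>-part of the gradient of the Hamiltonian is \<open>v\<close>, its
multiplier parts are \<open>g\<^sub>i(q) \<bullet> v\<close> and \<open>h\<^sub>i(q)\<close>, and its \<open>q\<close>-part is the negative of the position
gradient of the constrained Lagrangian at velocity \<open>v\<close> (\<open>grad_gen_hamiltonian\<close>,
\<open>grad_constrained_lagrangian_position\<close>). The first of the four blocks of the Hamiltonian system is
therefore the dynamical equation for \<open>p\<close>, the last two are the constraints, and the second,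
\<open>q' = v\<close>, says exactly that \<open>p\<close> is the velocity gradient of the constrained Lagrangian. This is
\<open>gen_ham_system_iff_euler_lagrange\<close>.

The multipliers of the velocity constraints enter the Hamiltonian quadratically, and the equations
\<open>g\<^sub>i(q) \<bullet> v = 0\<close> are linear in them with the Gram matrix \<open>g\<^sub>i \<bullet> M\<inverse> g\<^sub>j\<close>. If the \<open>g\<^sub>i\<close> are
independent and \<open>M\<inverse>\<close> does not degenerate on their span, this matrix is regular
(\<open>det_gram_nonzero\<close>), and Cramer's rule gives the multipliers as a smooth function of \<open>(q, p)\<close>.
Inserting this function into the Hamiltonian without its holonomic term gives a reduced
Hamiltonian. Its partial gradients are those computed with the multipliers held fixed, since the
Hamiltonian is stationary in them there (\<open>reduced_hamiltonian_has_derivative\<close>); hence the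
canonical equations are the generalized ones with the multipliers substituted.
\<close>

section \<open>Closure properties of smooth functions\<close>

text \<open>A derivative on the whole space is unique, so any family of derivatives may serve as a witness in
place of the canonical one. This lets the rules of differentiation be used directly in the
inductions on the order below.\<close>

lemma Cr_on_Suc_UNIV_iff:
  "Cr_on (Suc r) UNIV f \<longleftrightarrow>
     (\<exists>f'. (\<forall>x. (f has_derivative f' x) (at x)) \<and> (\<forall>v. Cr_on r UNIV (\<lambda>x. f' x v)))"
proof
  assume "Cr_on (Suc r) UNIV f"
  then show "\<exists>f'. (\<forall>x. (f has_derivative f' x) (at x)) \<and> (\<forall>v. Cr_on r UNIV (\<lambda>x. f' x v))"
    by (intro exI[of _ "\<lambda>x. frechet_derivative f (at x)"])
      (auto simp: differentiable_on_def frechet_derivative_works)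
next
  assume "\<exists>f'. (\<forall>x. (f has_derivative f' x) (at x)) \<and> (\<forall>v. Cr_on r UNIV (\<lambda>x. f' x v))"
  then obtain f' where f': "\<And>x. (f has_derivative f' x) (at x)"
    and r: "\<And>v. Cr_on r UNIV (\<lambda>x. f' x v)"
    by blast
  have "frechet_derivative f (at x) = f' x" for x
    using frechet_derivative_at[OF f'] by simp
  moreover have "f differentiable_on UNIV"
    unfolding differentiable_on_def differentiable_def using f' by blast
  ultimately show "Cr_on (Suc r) UNIV f"
    using r by simp
qed

lemma Cr_on_SucD: "Cr_on (Suc r) UNIV f \<Longrightarrow> Cr_on r UNIV f"
proof (induction r arbitrary: f)
  case 0
  then show ?case by (simp add: differentiable_imp_continuous_on)
next
  case (Suc r)
  have "f differentiable_on UNIV"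
    and "\<forall>v. Cr_on (Suc r) UNIV (\<lambda>x. frechet_derivative f (at x) v)"
    using Suc.prems unfolding Cr_on.simps(2)[of "Suc r"] by blast+
  then show ?case using Suc.IH unfolding Cr_on.simps(2)[of r] by blast
qed

lemma Cr_on_const: "Cr_on r UNIV (\<lambda>x. c)"
proof (induction r arbitrary: c)
  case (Suc r)
  show ?case
    unfolding Cr_on_Suc_UNIV_iff by (intro exI[of _ "\<lambda>x v. 0"]) (simp add: Suc)
qed simp

lemma Cr_on_add:
  "Cr_on r UNIV f \<Longrightarrow> Cr_on r UNIV g \<Longrightarrow> Cr_on r UNIV (\<lambda>x. f x + g x)"
proof (induction r arbitrary: f g)
  case 0
  then show ?case by (simp add: continuous_on_add)
next
  case (Suc r)
  from Suc.prems obtain f' g' where d: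
    "\<And>x. (f has_derivative f' x) (at x)" "\<And>v. Cr_on r UNIV (\<lambda>x. f' x v)"
    "\<And>x. (g has_derivative g' x) (at x)" "\<And>v. Cr_on r UNIV (\<lambda>x. g' x v)"
    unfolding Cr_on_Suc_UNIV_iff by blast
  show ?case
    unfolding Cr_on_Suc_UNIV_iff
    by (intro exI[of _ "\<lambda>x v. f' x v + g' x v"]) (intro conjI allI has_derivative_add Suc.IH d)
qed

lemma Cr_on_bilinear:
  assumes "bounded_bilinear B"
  shows "Cr_on r UNIV f \<Longrightarrow> Cr_on r UNIV g \<Longrightarrow> Cr_on r UNIV (\<lambda>x. B (f x) (g x))"
proof (induction r arbitrary: f g)
  case 0
  then show ?case by (simp add: bounded_bilinear.continuous_on[OF assms])
next
  case (Suc r)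
  from Suc.prems obtain f' g' where d:
    "\<And>x. (f has_derivative f' x) (at x)" "\<And>v. Cr_on r UNIV (\<lambda>x. f' x v)"
    "\<And>x. (g has_derivative g' x) (at x)" "\<And>v. Cr_on r UNIV (\<lambda>x. g' x v)"
    unfolding Cr_on_Suc_UNIV_iff by blast
  show ?case
    unfolding Cr_on_Suc_UNIV_iff
    by (intro exI[of _ "\<lambda>x v. B (f x) (g' x v) + B (f' x v) (g x)"])
      (intro conjI allI bounded_bilinear.FDERIV[OF assms] d Cr_on_add Suc.IH Cr_on_SucD[OF Suc.prems(1)]
        Cr_on_SucD[OF Suc.prems(2)])
qed

lemma Cr_on_linear:
  assumes "bounded_linear l"
  shows "Cr_on r UNIV l"
proof (cases r)
  case 0
  then show ?thesis using assms by (simp add: linear_continuous_on)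
next
  case (Suc r')
  show ?thesis
    unfolding Suc Cr_on_Suc_UNIV_iff
    by (intro exI[of _ "\<lambda>x. l"])
      (simp add: Cr_on_const bounded_linear_imp_has_derivative[OF assms])
qed

lemma Cr_on_compose_linear:
  assumes l: "bounded_linear l"
  shows "Cr_on r UNIV f \<Longrightarrow> Cr_on r UNIV (\<lambda>x. f (l x))"
proof (induction r arbitrary: f)
  case 0
  then show ?case
    using continuous_on_compose2[of UNIV f UNIV l] linear_continuous_on[OF l] by simp
next
  case (Suc r)
  from Suc.prems obtain f' where d:
    "\<And>x. (f has_derivative f' x) (at x)" "\<And>v. Cr_on r UNIV (\<lambda>x. f' x v)"
    unfolding Cr_on_Suc_UNIV_iff by blast
  have "((\<lambda>x. f (l x)) has_derivative (\<lambda>v. f' (l x) (l v))) (at x)" for x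
    by (rule has_derivative_compose[OF bounded_linear_imp_has_derivative[OF l] d(1)])
  moreover have "Cr_on r UNIV (\<lambda>x. f' (l x) (l v))" for v
    by (rule Suc.IH) (rule d(2))
  ultimately show ?case
    unfolding Cr_on_Suc_UNIV_iff by (intro exI[of _ "\<lambda>x v. f' (l x) (l v)"]) blast
qed

text \<open>The derivative of \<open>1/f\<close> is \<open>-(1/f) f' (1/f)\<close>, a product that contains \<open>1/f\<close> itself and no
further quotient, so each step of the induction on the order needs only the previous one.\<close>

lemma Cr_on_inverse:
  fixes f :: "'a::euclidean_space \<Rightarrow> real"
  assumes nz: "\<And>x. f x \<noteq> 0"
  shows "Cr_on r UNIV f \<Longrightarrow> Cr_on r UNIV (\<lambda>x. inverse (f x))"
proof (induction r)
  case 0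
  then show ?case using nz by (simp add: continuous_on_inverse)
next
  case (Suc r)
  from Suc.prems obtain f' where d:
    "\<And>x. (f has_derivative f' x) (at x)" "\<And>v. Cr_on r UNIV (\<lambda>x. f' x v)"
    unfolding Cr_on_Suc_UNIV_iff by blast
  have inv: "Cr_on r UNIV (\<lambda>x. inverse (f x))"
    using Suc.IH Cr_on_SucD[OF Suc.prems] .
  have inv': "Cr_on r UNIV (\<lambda>x. - (inverse (f x) * f' x v * inverse (f x)))" for v
    using Cr_on_bilinear[OF bounded_bilinear_mult Cr_on_const[of _ "- 1"]
        Cr_on_bilinear[OF bounded_bilinear_mult Cr_on_bilinear[OF bounded_bilinear_mult inv d(2)] inv]]
    by simp
  show ?case
    unfolding Cr_on_Suc_UNIV_iff
    by (intro exI[of _ "\<lambda>x v. - (inverse (f x) * f' x v * inverse (f x))"])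
      (intro conjI allI Deriv.has_derivative_inverse d nz inv')
qed

lemma smooth_on_const: "smooth_on UNIV (\<lambda>x. c)"
  unfolding smooth_on_def using Cr_on_const by blast

lemma smooth_on_linear: "bounded_linear l \<Longrightarrow> smooth_on UNIV l"
  unfolding smooth_on_def using Cr_on_linear by blast

lemma smooth_on_add:
  "smooth_on UNIV f \<Longrightarrow> smooth_on UNIV g \<Longrightarrow> smooth_on UNIV (\<lambda>x. f x + g x)"
  unfolding smooth_on_def by (simp add: Cr_on_add)

lemma smooth_on_bilinear:
  assumes "bounded_bilinear B" "smooth_on UNIV f" "smooth_on UNIV g"
  shows "smooth_on UNIV (\<lambda>x. B (f x) (g x))"
  using assms(2,3) unfolding smooth_on_def
  by (intro allI Cr_on_bilinear[OF assms(1)]) simp_all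

lemma smooth_on_compose_linear:
  assumes "bounded_linear l" "smooth_on UNIV f"
  shows "smooth_on UNIV (\<lambda>x. f (l x))"
  using assms(2) unfolding smooth_on_def
  by (intro allI, intro Cr_on_compose_linear[OF assms(1), where f = f]) simp

lemma smooth_on_inverse:
  fixes f :: "'a::euclidean_space \<Rightarrow> real"
  assumes "\<And>x. f x \<noteq> 0" "smooth_on UNIV f"
  shows "smooth_on UNIV (\<lambda>x. inverse (f x))"
  using assms(2) unfolding smooth_on_def by (intro allI Cr_on_inverse[of f, OF assms(1)]) simp

lemmas smooth_on_mult = smooth_on_bilinear[OF bounded_bilinear_mult]
  and smooth_on_scaleR = smooth_on_bilinear[OF bounded_bilinear_scaleR]
  and smooth_on_inner = smooth_on_bilinear[OF bounded_bilinear_inner]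


lemma smooth_on_sum:
  assumes "\<And>i. i \<in> I \<Longrightarrow> smooth_on UNIV (f i)"
  shows "smooth_on UNIV (\<lambda>x. \<Sum>i\<in>I. f i x)"
  using assms
proof (induction I rule: infinite_finite_induct)
  case (insert i I)
  have "smooth_on UNIV (\<lambda>x. f i x + (\<Sum>i\<in>I. f i x))"
    by (rule smooth_on_add) (use insert in blast)+
  then show ?case using insert.hyps by simp
qed (simp_all add: smooth_on_const)

lemma smooth_on_prod:
  fixes f :: "'i \<Rightarrow> 'a::euclidean_space \<Rightarrow> real"
  assumes "\<And>i. i \<in> I \<Longrightarrow> smooth_on UNIV (f i)"
  shows "smooth_on UNIV (\<lambda>x. \<Prod>i\<in>I. f i x)"
  using assms
proof (induction I rule: infinite_finite_induct)
  case (insert i I)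
  have "smooth_on UNIV (\<lambda>x. f i x * (\<Prod>i\<in>I. f i x))"
    by (rule smooth_on_mult) (use insert in blast)+
  then show ?case using insert.hyps by simp
qed (simp_all add: smooth_on_const)

text \<open>The Leibniz formula is a polynomial in the entries.\<close>

lemma smooth_on_det:
  fixes A :: "'a::euclidean_space \<Rightarrow> real^'m^'m"
  assumes "\<And>i j. smooth_on UNIV (\<lambda>x. A x $ i $ j)"
  shows "smooth_on UNIV (\<lambda>x. det (A x))"
  unfolding det_def
  by (rule smooth_on_sum, rule smooth_on_mult, rule smooth_on_const, rule smooth_on_prod, rule assms)

lemma smooth_on_vec:
  fixes f :: "'a::euclidean_space \<Rightarrow> real^'m"
  assumes "\<And>k. smooth_on UNIV (\<lambda>x. f x $ k)"
  shows "smooth_on UNIV f"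
proof -
  have expand: "(\<lambda>x. \<Sum>k\<in>UNIV. (f x $ k) *\<^sub>R axis k 1) = f"
    by (rule ext) (simp add: basis_expansion flip: scalar_mult_eq_scaleR)
  have "smooth_on UNIV (\<lambda>x. \<Sum>k\<in>UNIV. (f x $ k) *\<^sub>R axis k 1)"
    by (rule smooth_on_sum, rule smooth_on_scaleR, rule assms, rule smooth_on_const)
  then show ?thesis by (rule subst[OF expand])
qed

lemma smooth_on_component:
  fixes f :: "'a::euclidean_space \<Rightarrow> real^'m"
  assumes "smooth_on UNIV f"
  shows "smooth_on UNIV (\<lambda>x. f x $ k)"
proof -
  have "smooth_on UNIV (\<lambda>x. f x \<bullet> axis k 1)"
    by (rule smooth_on_inner[OF assms smooth_on_const])
  then show ?thesis by (simp add: inner_axis)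
qed

lemma smooth_on_UNIV_has_derivative:
  assumes "smooth_on UNIV f"
  shows "(f has_derivative frechet_derivative f (at x)) (at x)"
proof -
  have "Cr_on (Suc 0) UNIV f" using assms by (simp add: smooth_on_def del: Cr_on.simps)
  then show ?thesis by (simp add: differentiable_on_def frechet_derivative_works)
qed

section \<open>Gradients\<close>

text \<open>The two facts below replace the description by a unique choice: a gradient is
found by rewriting a derivative as an inner product, and inner products with it are directional
derivatives.\<close>

lemma grad_eqI:
  fixes f :: "'a::euclidean_space \<Rightarrow> real"
  assumes "(f has_derivative f') (at x)" and "\<And>d. f' d = d \<bullet> D"
  shows "grad f x = D"
proof -
  have "f' = (\<lambda>d. d \<bullet> D)" by (rule ext) (rule assms(2))
  with assms(1) have D: "GDERIV f x :> D" by (simp add: gderiv_def)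
  moreover have "D' = D" if "GDERIV f x :> D'" for D'
  proof -
    have "(\<lambda>d. d \<bullet> D') = (\<lambda>d. d \<bullet> D)"
      using that D unfolding gderiv_def by (rule has_derivative_unique)
    then have "\<forall>d. d \<bullet> D' = d \<bullet> D" by (rule fun_cong[THEN allI])
    then show ?thesis by (simp only: vector_eq_ldot)
  qed
  ultimately show ?thesis unfolding grad_def by (rule the_equality)
qed

lemma inner_grad:
  fixes f :: "'a::euclidean_space \<Rightarrow> real"
  assumes "(f has_derivative f') (at x)"
  shows "d \<bullet> grad f x = f' d"
proof -
  have l: "linear f'" using assms by (rule has_derivative_linear)
  have "grad f x = adjoint f' 1"
    using assms by (rule grad_eqI) (simp add: adjoint_works[OF l])
  then show ?thesis by (simp add: adjoint_works[OF l])
qed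

section \<open>Coordinates of the generalized phase space\<close>

text \<open>The inverse of \<open>phase_point\<close>, block by block. Since these maps are linear,
the chain rule applies to them, and a derivative in phase space can be written without indices.\<close>

definition position :: "('n::finite, 'k::finite, 'l::finite) phase \<Rightarrow> real^'n" where
  "position z = (\<chi> a. z $ Inl a)"

definition conj_momentum :: "('n::finite, 'k::finite, 'l::finite) phase \<Rightarrow> real^'n" where
  "conj_momentum z = (\<chi> a. z $ Inr (Inl a))"

definition velocity_multiplier :: "('n::finite, 'k::finite, 'l::finite) phase \<Rightarrow> real^'k" where
  "velocity_multiplier z = (\<chi> b. z $ Inr (Inr (Inl b)))"

definition holonomic_multiplier :: "('n::finite, 'k::finite, 'l::finite) phase \<Rightarrow> real^'l" where
  "holonomic_multiplier z = (\<chi> c. z $ Inr (Inr (Inr c)))"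

lemmas phase_coordinate_defs =
  position_def conj_momentum_def velocity_multiplier_def holonomic_multiplier_def

lemma phase_coordinates_of_phase_point [simp]:
  "position (phase_point x p lam mu) = x"
  "conj_momentum (phase_point x p lam mu) = p"
  "velocity_multiplier (phase_point x p lam mu) = lam"
  "holonomic_multiplier (phase_point x p lam mu) = mu"
  by (simp_all add: phase_coordinate_defs phase_point_def)

lemma phase_point_eq_iff:
  "phase_point x p lam mu = phase_point x' p' lam' mu' \<longleftrightarrow>
     x = x' \<and> p = p' \<and> lam = lam' \<and> mu = mu'"
  by (metis phase_coordinates_of_phase_point)

lemma bounded_linear_phase_coordinates:
  "bounded_linear position" "bounded_linear conj_momentum"
  "bounded_linear velocity_multiplier" "bounded_linear holonomic_multiplier"
  by (auto intro!: linear_conv_bounded_linear[THEN iffD1] linearI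
      simp: phase_coordinate_defs vec_eq_iff)

lemma sum_over_sum_type:
  fixes f :: "'a::finite + 'b::finite \<Rightarrow> real"
  shows "(\<Sum>i\<in>UNIV. f i) = (\<Sum>a\<in>UNIV. f (Inl a)) + (\<Sum>b\<in>UNIV. f (Inr b))"
proof -
  have "(\<Sum>i\<in>UNIV. f i) = (\<Sum>i\<in>UNIV <+> UNIV. f i)"
    by simp
  then show ?thesis
    by (simp add: sum.Plus del: UNIV_Plus_UNIV)
qed

lemma inner_phase_point:
  "d \<bullet> phase_point x p lam mu =
     position d \<bullet> x + conj_momentum d \<bullet> p + velocity_multiplier d \<bullet> lam + holonomic_multiplier d \<bullet> mu"
  unfolding inner_vec_def sum_over_sum_type phase_coordinate_defs phase_point_def by simp

lemma gen_J_mult_phase_point: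
  "gen_J *v phase_point x p lam mu = phase_point (- p) x 0 0"
proof -
  have "(gen_J *v phase_point x p lam mu) $ i = phase_point (- p) x 0 0 $ i" for i
    by (cases i; (cases "projr i"; (cases "projr (projr i)")?)?)
      (simp_all add: matrix_vector_mult_def sum_over_sum_type gen_J_def phase_point_def
        if_distrib[of "\<lambda>c. c * _"] cong: if_cong)
  then show ?thesis by (simp add: vec_eq_iff)
qed

lemma bounded_linear_phase_point:
  "bounded_linear (\<lambda>(x, p, lam, mu). phase_point x p lam mu)"
proof -
  have "linear (\<lambda>(x, p, lam, mu). phase_point x p lam mu)"
    by (rule linearI)
      (auto simp: phase_point_def vec_eq_iff split: sum.splits)
  then show ?thesis by (simp add: linear_conv_bounded_linear)
qed

lemma phase_point_has_vector_derivative: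
  assumes "(q has_vector_derivative q') (at t within T)" "(p has_vector_derivative p') (at t within T)"
    "(lam has_vector_derivative lam') (at t within T)" "(mu has_vector_derivative mu') (at t within T)"
  shows "((\<lambda>t. phase_point (q t) (p t) (lam t) (mu t)) has_vector_derivative
           phase_point q' p' lam' mu') (at t within T)"
  using bounded_linear.has_vector_derivative[OF bounded_linear_phase_point
      has_vector_derivative_Pair[OF assms(1) has_vector_derivative_Pair[OF assms(2)
        has_vector_derivative_Pair[OF assms(3,4)]]]]
  by simp

lemma differentiable_on_bounded_linear_image:
  assumes "bounded_linear l" "f differentiable_on T"
  shows "(\<lambda>t. l (f t)) differentiable_on T"
  unfolding differentiable_on_def
proof
  fix t assume "t \<in> T"
  then obtain D where "(f has_derivative D) (at t within T)"
    using assms(2) unfolding differentiable_on_def differentiable_def by blast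
  then show "(\<lambda>t. l (f t)) differentiable at t within T"
    by (rule differentiableI[OF bounded_linear.has_derivative[OF assms(1)]])
qed

text \<open>For the direction from left to right, each block is recovered by a linear coordinate map.\<close>

lemma phase_point_differentiable_on_iff:
  fixes T :: "real set"
  shows "(\<lambda>t. phase_point (q t) (p t) (lam t) (mu t)) differentiable_on T \<longleftrightarrow>
     q differentiable_on T \<and> p differentiable_on T \<and> lam differentiable_on T \<and> mu differentiable_on T"
  (is "?z differentiable_on T \<longleftrightarrow> ?r")
proof
  assume z: "?z differentiable_on T"
  note coordinate =
    bounded_linear_phase_coordinates[THEN differentiable_on_bounded_linear_image, OF z]
  show ?r using coordinate by simp
next
  assume r: ?r
  show "?z differentiable_on T"
    unfolding differentiable_on_def
  proof
    fix t assume "t \<in> T"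
    with r have "((\<lambda>t. phase_point (q t) (p t) (lam t) (mu t)) has_vector_derivative phase_point
        (vector_derivative q (at t within T)) (vector_derivative p (at t within T))
        (vector_derivative lam (at t within T)) (vector_derivative mu (at t within T))) (at t within T)"
      by (intro phase_point_has_vector_derivative) (simp_all add: differentiable_on_def
          flip: vector_derivative_works)
    then show "?z differentiable at t within T" by (rule differentiableI_vector)
  qed
qed

section \<open>Derivatives on a compact interval\<close>

lemma vector_derivative_eqI_Icc:
  fixes f :: "real \<Rightarrow> 'a::real_normed_vector"
  assumes "a < b" "t \<in> {a..b}" "(f has_vector_derivative f') (at t within {a..b})"
  shows "vector_derivative f (at t within {a..b}) = f'"
  using vector_derivative_within_cbox[of a b t f f'] assms by simp

lemma differentiable_on_has_vector_derivative:
  assumes "f differentiable_on T" "t \<in> T"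
  shows "(f has_vector_derivative vector_derivative f (at t within T)) (at t within T)"
  using assms unfolding differentiable_on_def vector_derivative_works by blast

lemma vector_derivative_cong_on:
  assumes "\<And>s. s \<in> T \<Longrightarrow> f s = g s" "t \<in> T"
  shows "vector_derivative f (at t within T) = vector_derivative g (at t within T)"
proof -
  have "(f has_vector_derivative d) (at t within T) \<longleftrightarrow> (g has_vector_derivative d) (at t within T)" for d
    using has_vector_derivative_transform[OF assms(2), of f g d]
      has_vector_derivative_transform[OF assms(2), of g f d] assms(1) by auto
  then show ?thesis unfolding vector_derivative_def by simp
qed

lemma differentiable_on_cong:
  assumes "\<And>s. s \<in> T \<Longrightarrow> f s = g s"
  shows "f differentiable_on T \<longleftrightarrow> g differentiable_on T"
  unfolding differentiable_on_def differentiable_def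
  using has_derivative_transform assms by metis

section \<open>The mechanical system\<close>

locale constrained_mechanics =
  fixes M :: "real^'n^'n"
    and V :: "real^'n \<Rightarrow> real"
    and K :: "'k::finite set" and g :: "'k \<Rightarrow> real^'n \<Rightarrow> real^'n"
    and L :: "'l::finite set" and h :: "'l \<Rightarrow> real^'n \<Rightarrow> real"
  assumes symmetric_M: "transpose M = M" and invertible_M: "invertible M"
    and smooth_V: "smooth_on UNIV V"
    and smooth_g: "i \<in> K \<Longrightarrow> smooth_on UNIV (g i)"
    and differentiable_h: "j \<in> L \<Longrightarrow> h j differentiable_on UNIV"
begin

abbreviation "W \<equiv> matrix_inv M"

text \<open>Along a motion this is \<open>M q'\<close>; the canonical momentum \<open>p\<close> differs from it by the
contribution of the velocity constraints to the velocity gradient of the Lagrangian.\<close>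

definition kinetic_momentum :: "real^'n \<Rightarrow> real^'n \<Rightarrow> real^'k \<Rightarrow> real^'n" where
  "kinetic_momentum x p lam = p + (\<Sum>i\<in>K. lam $ i *\<^sub>R g i x)"

definition velocity :: "real^'n \<Rightarrow> real^'n \<Rightarrow> real^'k \<Rightarrow> real^'n" where
  "velocity x p lam = W *v kinetic_momentum x p lam"

definition energy :: "real^'n \<Rightarrow> real^'n \<Rightarrow> real^'k \<Rightarrow> real" where
  "energy x p lam = 1/2 * (kinetic_momentum x p lam \<bullet> velocity x p lam) + V x"

text \<open>The sum of the \<open>\<lambda>\<^sub>i (Dg\<^sub>i)\<^sup>T v\<close>, written as a gradient with the velocity held fixed. It is,
up to sign, the part of both position gradients, Lagrangian and Hamiltonian, that comes from the
dependence of the \<open>g\<^sub>i\<close> on the position.\<close>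

definition constraint_force :: "real^'k \<Rightarrow> real^'n \<Rightarrow> real^'n \<Rightarrow> real^'n" where
  "constraint_force lam v x = grad (\<lambda>y. \<Sum>i\<in>K. lam $ i * (g i y \<bullet> v)) x"

lemma M_W: "M *v (W *v x) = x" and W_M: "W *v (M *v x) = x"
proof -
  have "M ** W = mat 1 \<and> W ** M = mat 1"
    using invertible_M unfolding invertible_def matrix_inv_def by (rule someI_ex)
  then show "M *v (W *v x) = x" "W *v (M *v x) = x"
    by (simp_all add: matrix_vector_mul_assoc)
qed

lemma inner_M: "x \<bullet> (M *v y) = (M *v x) \<bullet> y"
  by (metis dot_lmul_matrix symmetric_M transpose_matrix_vector)

lemma inner_W: "x \<bullet> (W *v y) = (W *v x) \<bullet> y"
  by (metis inner_M M_W)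

lemma has_derivative_quadratic_form:
  assumes A: "\<And>x y. x \<bullet> (A *v y) = (A *v x) \<bullet> (y :: real^'n)"
    and w: "(w has_derivative w') (at z)"
  shows "((\<lambda>z. 1/2 * (w z \<bullet> (A *v w z))) has_derivative (\<lambda>d. w' d \<bullet> (A *v w z))) (at z)"
proof -
  have "((\<lambda>z. A *v w z) has_derivative (\<lambda>d. A *v w' d)) (at z)"
    by (rule bounded_linear.has_derivative[OF matrix_vector_mul_bounded_linear w])
  then have "((\<lambda>z. 1/2 * (w z \<bullet> (A *v w z))) has_derivative
      (\<lambda>d. 1/2 * (w z \<bullet> (A *v w' d) + w' d \<bullet> (A *v w z)))) (at z)"
    by (intro has_derivative_mult_right has_derivative_inner w)
  moreover have "1/2 * (w z \<bullet> (A *v w' d) + w' d \<bullet> (A *v w z)) = w' d \<bullet> (A *v w z)" for d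
    by (simp add: A[of "w z"] inner_commute)
  ultimately show ?thesis by (simp only:)
qed

lemma g_has_derivative:
  "i \<in> K \<Longrightarrow> (g i has_derivative frechet_derivative (g i) (at x)) (at x)"
  by (rule smooth_on_UNIV_has_derivative[OF smooth_g])

lemma V_has_derivative: "(V has_derivative (\<lambda>d. d \<bullet> grad V x)) (at x)"
  using smooth_on_UNIV_has_derivative[OF smooth_V, of x] by (simp add: inner_grad)

lemma h_has_derivative: "i \<in> L \<Longrightarrow> (h i has_derivative (\<lambda>d. d \<bullet> grad (h i) x)) (at x)"
proof -
  assume "i \<in> L"
  then have "(h i has_derivative frechet_derivative (h i) (at x)) (at x)"
    using differentiable_h by (simp add: differentiable_on_def frechet_derivative_works)
  then show ?thesis by (simp add: inner_grad)
qed

lemma constraint_work_has_derivative: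
  "((\<lambda>y. \<Sum>i\<in>K. lam $ i * (g i y \<bullet> v)) has_derivative
      (\<lambda>d. \<Sum>i\<in>K. lam $ i * (frechet_derivative (g i) (at x) d \<bullet> v))) (at x)"
  by (intro has_derivative_sum has_derivative_mult_right has_derivative_inner_left g_has_derivative)

lemma inner_constraint_force:
  "d \<bullet> constraint_force lam v x = (\<Sum>i\<in>K. lam $ i * (frechet_derivative (g i) (at x) d \<bullet> v))"
  unfolding constraint_force_def by (rule inner_grad[OF constraint_work_has_derivative])

lemma kinetic_momentum_cong:
  "(\<And>i. i \<in> K \<Longrightarrow> lam $ i = lam' $ i) \<Longrightarrow> kinetic_momentum x p lam = kinetic_momentum x p lam'"
  unfolding kinetic_momentum_def by simp

lemma constraint_force_cong:
  "(\<And>i. i \<in> K \<Longrightarrow> lam $ i = lam' $ i) \<Longrightarrow> constraint_force lam v x = constraint_force lam' v x"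
  unfolding constraint_force_def by simp

lemma velocity_cong:
  "(\<And>i. i \<in> K \<Longrightarrow> lam $ i = lam' $ i) \<Longrightarrow> velocity x p lam = velocity x p lam'"
  unfolding velocity_def by (rule arg_cong[OF kinetic_momentum_cong])

lemma eq_velocity_iff:
  "v = velocity x p lam \<longleftrightarrow> p = M *v v - (\<Sum>i\<in>K. lam $ i *\<^sub>R g i x)"
proof -
  have "v = velocity x p lam \<longleftrightarrow> M *v v = kinetic_momentum x p lam"
    unfolding velocity_def using M_W[of "kinetic_momentum x p lam"] W_M[of v] by auto
  then show ?thesis unfolding kinetic_momentum_def by (auto simp: algebra_simps)
qed

text \<open>The common source of the gradients of the generalized and of the reduced Hamiltonian: position,
momentum and multipliers are arbitrary differentiable functions of a parameter. The last sum collects the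
dependence through the multipliers; it vanishes wherever the velocity constraints hold.\<close>

lemma energy_has_derivative:
  assumes X: "(X has_derivative X') (at z)" and P: "(P has_derivative P') (at z)"
    and Lam: "(Lam has_derivative Lam') (at z)"
  shows "((\<lambda>z. energy (X z) (P z) (Lam z)) has_derivative
    (\<lambda>d. P' d \<bullet> velocity (X z) (P z) (Lam z)
       + X' d \<bullet> (constraint_force (Lam z) (velocity (X z) (P z) (Lam z)) (X z) + grad V (X z))
       + (\<Sum>i\<in>K. Lam' d $ i * (g i (X z) \<bullet> velocity (X z) (P z) (Lam z))))) (at z)"
proof -
  let ?Dg = "\<lambda>i. frechet_derivative (g i) (at (X z))"
  let ?v = "velocity (X z) (P z) (Lam z)"
  have lam: "((\<lambda>z. Lam z $ i) has_derivative (\<lambda>d. Lam' d $ i)) (at z)" for i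
    by (rule bounded_linear.has_derivative[OF bounded_linear_vec_nth Lam])
  have "((\<lambda>z. kinetic_momentum (X z) (P z) (Lam z)) has_derivative
    (\<lambda>d. P' d + (\<Sum>i\<in>K. Lam z $ i *\<^sub>R ?Dg i (X' d) + Lam' d $ i *\<^sub>R g i (X z)))) (at z)"
    unfolding kinetic_momentum_def
    by (intro has_derivative_add P has_derivative_sum has_derivative_scaleR lam
        has_derivative_compose[OF X g_has_derivative])
  from has_derivative_quadratic_form[OF inner_W this]
  have "((\<lambda>z. energy (X z) (P z) (Lam z)) has_derivative
    (\<lambda>d. (P' d + (\<Sum>i\<in>K. Lam z $ i *\<^sub>R ?Dg i (X' d) + Lam' d $ i *\<^sub>R g i (X z))) \<bullet> ?v
       + X' d \<bullet> grad V (X z))) (at z)"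
    unfolding energy_def velocity_def
    by (rule has_derivative_add[OF _ has_derivative_compose[OF X V_has_derivative]])
  moreover have "(P' d + (\<Sum>i\<in>K. Lam z $ i *\<^sub>R ?Dg i (X' d) + Lam' d $ i *\<^sub>R g i (X z))) \<bullet> ?v
       + X' d \<bullet> grad V (X z) = P' d \<bullet> ?v
       + X' d \<bullet> (constraint_force (Lam z) ?v (X z) + grad V (X z))
       + (\<Sum>i\<in>K. Lam' d $ i * (g i (X z) \<bullet> ?v))" for d
    by (simp add: inner_add_left inner_add_right inner_sum_left sum.distrib inner_constraint_force)
  ultimately show ?thesis by (simp only:)
qed

section \<open>Euler-Lagrange equations and the generalized Hamiltonian system\<close>

lemma grad_constrained_lagrangian_velocity:
  "grad (\<lambda>v. constrained_lagrangian M V K g L h x v lam mu) v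
     = M *v v - (\<Sum>i\<in>K. lam $ i *\<^sub>R g i x)"
proof (rule grad_eqI)
  show "((\<lambda>v. constrained_lagrangian M V K g L h x v lam mu) has_derivative
      (\<lambda>d. d \<bullet> (M *v v) - 0 - (\<Sum>i\<in>K. lam $ i * (g i x \<bullet> d)) - 0)) (at v)"
    unfolding constrained_lagrangian_def lagrangian_def
    by (intro has_derivative_diff has_derivative_quadratic_form[OF inner_M] has_derivative_const
        has_derivative_sum has_derivative_mult_right has_derivative_inner_right has_derivative_ident)
qed (simp add: inner_diff_right inner_sum_right inner_commute)

lemma grad_constrained_lagrangian_position:
  "grad (\<lambda>x. constrained_lagrangian M V K g L h x v lam mu) x
     = - (constraint_force lam v x + grad V x + (\<Sum>i\<in>L. mu $ i *\<^sub>R grad (h i) x))"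
proof (rule grad_eqI)
  show "((\<lambda>x. constrained_lagrangian M V K g L h x v lam mu) has_derivative
      (\<lambda>d. 0 - d \<bullet> grad V x - (\<Sum>i\<in>K. lam $ i * (frechet_derivative (g i) (at x) d \<bullet> v))
         - (\<Sum>i\<in>L. mu $ i * (d \<bullet> grad (h i) x)))) (at x)"
    unfolding constrained_lagrangian_def lagrangian_def
    by (intro has_derivative_diff has_derivative_const V_has_derivative
        constraint_work_has_derivative has_derivative_sum[of L] has_derivative_mult_right h_has_derivative)
qed (simp add: inner_add_right inner_diff_right inner_sum_right inner_constraint_force)

lemma grad_gen_hamiltonian:
  "grad (gen_hamiltonian M V K g L h) (phase_point x p lam mu) = phase_point
     (constraint_force lam (velocity x p lam) x + grad V x + (\<Sum>i\<in>L. mu $ i *\<^sub>R grad (h i) x))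
     (velocity x p lam)
     (\<chi> i. if i \<in> K then g i x \<bullet> velocity x p lam else 0)
     (\<chi> i. if i \<in> L then h i x else 0)"
proof (rule grad_eqI)
  let ?z = "phase_point x p lam mu :: ('n, 'k, 'l) phase" and ?v = "velocity x p lam"
  note pos = bounded_linear_imp_has_derivative[OF bounded_linear_phase_coordinates(1)]
    and mom = bounded_linear_imp_has_derivative[OF bounded_linear_phase_coordinates(2)]
    and vel = bounded_linear_imp_has_derivative[OF bounded_linear_phase_coordinates(3)]
    and hol = bounded_linear_imp_has_derivative[OF bounded_linear_phase_coordinates(4)]
  have H: "gen_hamiltonian M V K g L h = (\<lambda>z.
      energy (position z) (conj_momentum z) (velocity_multiplier z)
      + (\<Sum>i\<in>L. holonomic_multiplier z $ i * h i (position z)))"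
    unfolding gen_hamiltonian_def energy_def velocity_def kinetic_momentum_def
      phase_coordinate_defs Let_def by (rule ext) simp
  have energy: "((\<lambda>z. energy (position z) (conj_momentum z) (velocity_multiplier z)) has_derivative
    (\<lambda>d. conj_momentum d \<bullet> ?v + position d \<bullet> (constraint_force lam ?v x + grad V x)
       + (\<Sum>i\<in>K. velocity_multiplier d $ i * (g i x \<bullet> ?v)))) (at ?z)"
    using energy_has_derivative[OF pos mom vel, of ?z] by simp
  have "((\<lambda>z. holonomic_multiplier z $ i * h i (position z)) has_derivative
    (\<lambda>d. mu $ i * (position d \<bullet> grad (h i) x) + holonomic_multiplier d $ i * h i x)) (at ?z)"
    if "i \<in> L" for i
    using has_derivative_mult[OF bounded_linear.has_derivative[OF bounded_linear_vec_nth hol]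
        has_derivative_compose[OF pos h_has_derivative[OF that]], of _ ?z] by simp
  then show "(gen_hamiltonian M V K g L h has_derivative
    (\<lambda>d. conj_momentum d \<bullet> ?v + position d \<bullet> (constraint_force lam ?v x + grad V x)
       + (\<Sum>i\<in>K. velocity_multiplier d $ i * (g i x \<bullet> ?v))
       + (\<Sum>i\<in>L. mu $ i * (position d \<bullet> grad (h i) x) + holonomic_multiplier d $ i * h i x))) (at ?z)"
    unfolding H by (intro has_derivative_add[OF energy] has_derivative_sum)
next
  have select: "(\<chi> i. if i \<in> S then c i else 0) \<bullet> y = (\<Sum>i\<in>S. y $ i * c i)"
    for S and c :: "'m::finite \<Rightarrow> real" and y
    unfolding inner_vec_def by (rule sum.mono_neutral_cong_right) auto
  fix d :: "('n, 'k, 'l) phase"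
  show "conj_momentum d \<bullet> velocity x p lam
       + position d \<bullet> (constraint_force lam (velocity x p lam) x + grad V x)
       + (\<Sum>i\<in>K. velocity_multiplier d $ i * (g i x \<bullet> velocity x p lam))
       + (\<Sum>i\<in>L. mu $ i * (position d \<bullet> grad (h i) x) + holonomic_multiplier d $ i * h i x)
     = d \<bullet> phase_point
     (constraint_force lam (velocity x p lam) x + grad V x + (\<Sum>i\<in>L. mu $ i *\<^sub>R grad (h i) x))
     (velocity x p lam)
     (\<chi> i. if i \<in> K then g i x \<bullet> velocity x p lam else 0)
     (\<chi> i. if i \<in> L then h i x else 0)"
    unfolding inner_phase_point inner_commute[of _ "vec_lambda _"] select
    by (simp add: inner_add_right inner_sum_right sum.distrib)
qed

lemma euler_lagrange_iff:
  "euler_lagrange M V K g L h T q lam mu \<longleftrightarrow>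
     q differentiable_on T \<and> lam differentiable_on T \<and> mu differentiable_on T \<and>
     momentum M K g T q lam differentiable_on T \<and>
     (\<forall>t\<in>T. vector_derivative (momentum M K g T q lam) (at t within T) =
          - (constraint_force (lam t) (vector_derivative q (at t within T)) (q t) + grad V (q t)
             + (\<Sum>i\<in>L. mu t $ i *\<^sub>R grad (h i) (q t))) \<and>
        (\<forall>i\<in>K. g i (q t) \<bullet> vector_derivative q (at t within T) = 0) \<and>
        (\<forall>i\<in>L. h i (q t) = 0))"
proof -
  have mom: "momentum M K g T q lam =
      (\<lambda>t. M *v vector_derivative q (at t within T) - (\<Sum>i\<in>K. lam t $ i *\<^sub>R g i (q t)))"
    by (rule ext) (simp add: momentum_def)
  show ?thesis
    unfolding euler_lagrange_def Let_def grad_constrained_lagrangian_velocity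
      grad_constrained_lagrangian_position mom right_minus_eq by (rule refl)
qed

lemma gen_ham_system_iff:
  assumes "a < b"
  shows "gen_ham_system M V K g L h {a..b} (\<lambda>t. phase_point (q t) (p t) (lam t) (mu t)) \<longleftrightarrow>
     q differentiable_on {a..b} \<and> p differentiable_on {a..b} \<and>
     lam differentiable_on {a..b} \<and> mu differentiable_on {a..b} \<and>
     (\<forall>t\<in>{a..b}. vector_derivative q (at t within {a..b}) = velocity (q t) (p t) (lam t) \<and>
        vector_derivative p (at t within {a..b}) =
          - (constraint_force (lam t) (velocity (q t) (p t) (lam t)) (q t) + grad V (q t)
             + (\<Sum>i\<in>L. mu t $ i *\<^sub>R grad (h i) (q t))) \<and>
        (\<forall>i\<in>K. g i (q t) \<bullet> velocity (q t) (p t) (lam t) = 0) \<and>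
        (\<forall>i\<in>L. h i (q t) = 0))"
    (is "_ \<longleftrightarrow> ?q \<and> ?p \<and> ?lam \<and> ?mu \<and> (\<forall>t\<in>{a..b}. ?eqs t)")
proof -
  let ?z = "\<lambda>t. phase_point (q t) (p t) (lam t) (mu t) :: ('n, 'k, 'l) phase"
  let ?T = "{a..b}"
  have eqs: "gen_J *v vector_derivative ?z (at t within ?T) = grad (gen_hamiltonian M V K g L h) (?z t)
      \<longleftrightarrow> ?eqs t"
    if d: "?q" "?p" "?lam" "?mu" and t: "t \<in> ?T" for t
  proof -
    have "vector_derivative ?z (at t within ?T) = phase_point
        (vector_derivative q (at t within ?T)) (vector_derivative p (at t within ?T))
        (vector_derivative lam (at t within ?T)) (vector_derivative mu (at t within ?T))"
      using assms t d
      by (intro vector_derivative_eqI_Icc phase_point_has_vector_derivative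
          differentiable_on_has_vector_derivative)
    moreover have "- u = w \<longleftrightarrow> u = - w" for u w :: "real^'n"
      by auto
    ultimately show ?thesis
      unfolding grad_gen_hamiltonian
      by (auto simp: gen_J_mult_phase_point phase_point_eq_iff vec_eq_iff[of 0])
  qed
  show ?thesis
    unfolding gen_ham_system_def phase_point_differentiable_on_iff using eqs by blast
qed

text \<open>The equation \<open>q' = v\<close> holds if and only if \<open>p\<close> is the momentum of \<open>q\<close>, and
once it holds, the remaining equations of the two systems agree term by term.\<close>

lemma gen_ham_system_iff_euler_lagrange:
  assumes "a < b"
  shows "gen_ham_system M V K g L h {a..b} (\<lambda>t. phase_point (q t) (p t) (lam t) (mu t)) \<longleftrightarrow>
     euler_lagrange M V K g L h {a..b} q lam mu \<and>
     (\<forall>t\<in>{a..b}. p t = momentum M K g {a..b} q lam t)"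
proof -
  let ?T = "{a..b}"
  have legendre: "vector_derivative q (at t within ?T) = velocity (q t) (p t) (lam t)
      \<longleftrightarrow> p t = momentum M K g ?T q lam t" for t
    unfolding eq_velocity_iff momentum_def ..
  show ?thesis
  proof (cases "\<forall>t\<in>?T. p t = momentum M K g ?T q lam t")
    case True
    have v: "velocity (q t) (p t) (lam t) = vector_derivative q (at t within ?T)" if "t \<in> ?T" for t
      using that True legendre[of t] by simp
    have differentiable:
      "p differentiable_on ?T \<longleftrightarrow> momentum M K g ?T q lam differentiable_on ?T"
      using True by (intro differentiable_on_cong) blast
    have p': "vector_derivative p (at t within ?T)
        = vector_derivative (momentum M K g ?T q lam) (at t within ?T)" if "t \<in> ?T" for t
      using True that by (intro vector_derivative_cong_on) auto
    show ?thesis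
      unfolding gen_ham_system_iff[OF assms] euler_lagrange_iff differentiable
      by (simp only: v p' cong: ball_cong) (use True in blast)
  next
    case False
    then show ?thesis unfolding gen_ham_system_iff[OF assms] legendre by blast
  qed
qed

end

section \<open>Elimination of the velocity multipliers\<close>

lemma lin_indep_familyD:
  fixes u :: "'k::finite \<Rightarrow> 'v::real_vector"
  assumes "lin_indep_family K u" and "(\<Sum>j\<in>K. c j *\<^sub>R u j) = 0" and "i \<in> K"
  shows "c i = 0"
proof -
  have inj: "inj_on u K" and ind: "independent (u ` K)"
    using assms(1) by (auto simp: lin_indep_family_def)
  have "(\<Sum>v\<in>u ` K. c (the_inv_into K u v) *\<^sub>R v) = (\<Sum>j\<in>K. c j *\<^sub>R u j)"
    using inj by (simp add: sum.reindex the_inv_into_f_f)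
  then have "c (the_inv_into K u (u i)) = 0"
    using assms(2,3) by (intro independentD[OF ind, of "u ` K" "\<lambda>v. c (the_inv_into K u v)"]) auto
  then show ?thesis using inj assms(3) by (simp add: the_inv_into_f_f)
qed

context constrained_mechanics
begin

text \<open>The Gram matrix of the constraint vectors with respect to \<open>M\<inverse>\<close>, on the indices in \<open>K\<close>.
It is continued by the identity to the other indices: determinants and Cramer's rule
concern matrices over a whole index type, and this continuation does not couple the two blocks.\<close>

definition gram :: "real^'n \<Rightarrow> real^'k^'k" where
  "gram x = (\<chi> i j. if i \<in> K \<and> j \<in> K then g i x \<bullet> (W *v g j x) else if i = j then 1 else 0)"

definition gram_rhs :: "real^'n \<Rightarrow> real^'n \<Rightarrow> real^'k" where
  "gram_rhs x p = (\<chi> i. if i \<in> K then - (g i x \<bullet> (W *v p)) else 0)"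

text \<open>Cramer's rule for the linear system that the velocity constraints impose on the multipliers.
The explicit quotient makes smoothness visible.\<close>

definition multiplier :: "real^'n \<Rightarrow> real^'n \<Rightarrow> real^'k" where
  "multiplier x p =
     (\<chi> k. det (\<chi> i j. if j = k then gram_rhs x p $ i else gram x $ i $ j) / det (gram x))"

lemma gram_mult:
  "(gram x *v c) $ i =
     (if i \<in> K then g i x \<bullet> (W *v (\<Sum>j\<in>K. c $ j *\<^sub>R g j x)) else c $ i)"
proof (cases "i \<in> K")
  case True
  have "(gram x *v c) $ i = (\<Sum>j\<in>UNIV. gram x $ i $ j * c $ j)"
    by (simp add: matrix_vector_mult_def)
  also have "\<dots> = (\<Sum>j\<in>K. c $ j * (g i x \<bullet> (W *v g j x)))"
    using True by (intro sum.mono_neutral_cong_right) (auto simp: gram_def)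
  finally show ?thesis
    using True by (simp add: inner_W inner_sum_right)
next
  case False
  then have "(gram x *v c) $ i = (\<Sum>j\<in>UNIV. if j = i then c $ j else 0)"
    unfolding matrix_vector_mult_def vec_lambda_beta gram_def by (intro sum.cong) auto
  then show ?thesis using False by simp
qed

text \<open>A vector in the kernel of the Gram matrix gives a combination \<open>u\<close> of the \<open>g\<^sub>i\<close> for which \<open>M\<inverse> u\<close>
is orthogonal to all \<open>g\<^sub>i\<close>. Nondegeneracy forces \<open>u = 0\<close>, and independence makes the
coefficients vanish.\<close>

lemma det_gram_nonzero:
  assumes indep: "lin_indep_family K (\<lambda>i. g i x)"
    and nondeg: "nondegenerate_on W (span ((\<lambda>i. g i x) ` K))"
  shows "det (gram x) \<noteq> 0"
proof -
  have "c = 0" if c: "gram x *v c = 0" for c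
  proof -
    define u where "u = (\<Sum>j\<in>K. c $ j *\<^sub>R g j x)"
    let ?S = "(\<lambda>i. g i x) ` K"
    have rows: "(if i \<in> K then g i x \<bullet> (W *v u) else c $ i) = 0" for i
      unfolding u_def gram_mult[symmetric] by (simp add: c)
    have "orthogonal (W *v u) y" if y: "y \<in> ?S" for y
    proof -
      obtain i where "i \<in> K" "y = g i x" using y by blast
      then show ?thesis using rows[of i] by (simp add: orthogonal_def inner_commute)
    qed
    then have "orthogonal (W *v u) w" if "w \<in> span ?S" for w
      using that orthogonal_to_span by blast
    moreover have "u \<in> span ?S"
      unfolding u_def by (intro span_sum span_scale span_base) blast
    ultimately have "u = 0"
      using nondeg unfolding nondegenerate_on_def by (simp add: orthogonal_def inner_commute)
    then have "c $ i = 0" if "i \<in> K" for i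
      using lin_indep_familyD[OF indep _ that, of "\<lambda>j. c $ j"] by (simp add: u_def)
    then show "c = 0" using rows by (metis vec_eq_iff zero_index)
  qed
  then have "\<exists>B. B ** gram x = mat 1" by (simp add: matrix_left_invertible_ker)
  then show ?thesis by (simp add: invertible_left_inverse flip: invertible_det_nz)
qed

lemma constraints_iff_multiplier:
  assumes nz: "det (gram x) \<noteq> 0"
  shows "(\<forall>i\<in>K. g i x \<bullet> velocity x p lam = 0) \<longleftrightarrow> (\<forall>i\<in>K. lam $ i = multiplier x p $ i)"
proof -
  have cramer_multiplier: "gram x *v c = gram_rhs x p \<longleftrightarrow> c = multiplier x p" for c
    unfolding multiplier_def using nz by (rule cramer)
  \<comment> \<open>Only the coordinates in \<open>K\<close> occur in the constraints, whereas Cramer's rule determines all of them; the others are set to zero, which is their value in \<open>multiplier\<close>.\<close>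
  define lam0 where "lam0 = (\<chi> i. if i \<in> K then lam $ i else 0)"
  have lam0: "(\<Sum>j\<in>K. lam0 $ j *\<^sub>R g j x) = (\<Sum>j\<in>K. lam $ j *\<^sub>R g j x)"
    by (simp add: lam0_def)
  have "g i x \<bullet> velocity x p lam = 0 \<longleftrightarrow> (gram x *v lam0) $ i = gram_rhs x p $ i" if "i \<in> K" for i
    using that
    by (auto simp: gram_mult lam0 gram_rhs_def velocity_def kinetic_momentum_def
        matrix_vector_right_distrib inner_add_right)
  moreover have "(gram x *v lam0) $ i = gram_rhs x p $ i" if "i \<notin> K" for i
    using that by (simp add: gram_mult gram_rhs_def lam0_def)
  ultimately have "(\<forall>i\<in>K. g i x \<bullet> velocity x p lam = 0) \<longleftrightarrow> gram x *v lam0 = gram_rhs x p"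
    unfolding vec_eq_iff by blast
  also have "\<dots> \<longleftrightarrow> lam0 = multiplier x p"
    by (rule cramer_multiplier)
  also have "\<dots> \<longleftrightarrow> (\<forall>i\<in>K. lam $ i = multiplier x p $ i)"
  proof -
    have "multiplier x p $ i = 0" if "i \<notin> K" for i
      using that gram_mult[of x "multiplier x p" i] cramer_multiplier[of "multiplier x p"]
      by (simp add: gram_rhs_def)
    then show ?thesis by (auto simp: vec_eq_iff lam0_def)
  qed
  finally show ?thesis .
qed

end

text \<open>Independence of the velocity constraints and nondegeneracy of \<open>M\<inverse>\<close> on their span enter the
elimination only through the regularity of the Gram matrix at every position.\<close>

locale regular_constrained_mechanics = constrained_mechanics M V K g L h
  for M :: "real^'n^'n"
    and V :: "real^'n \<Rightarrow> real"
    and K :: "'k::finite set" and g :: "'k \<Rightarrow> real^'n \<Rightarrow> real^'n"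
    and L :: "'l::finite set" and h :: "'l \<Rightarrow> real^'n \<Rightarrow> real" +
  assumes det_gram: "det (gram x) \<noteq> 0"
begin

lemmas multiplier_iff = constraints_iff_multiplier[OF det_gram]

lemma smooth_g_fst: "i \<in> K \<Longrightarrow> smooth_on UNIV (\<lambda>z :: (real^'n) \<times> (real^'n). g i (fst z))"
  by (rule smooth_on_compose_linear[OF bounded_linear_fst smooth_g])

lemma smooth_W_mult:
  fixes f :: "'a::euclidean_space \<Rightarrow> real^'n"
  assumes "smooth_on UNIV f"
  shows "smooth_on UNIV (\<lambda>z. W *v f z)"
proof -
  have "smooth_on UNIV (\<lambda>z. \<Sum>j\<in>UNIV. W $ i $ j * f z $ j)" for i
    by (rule smooth_on_sum, rule smooth_on_mult, rule smooth_on_const,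
        rule smooth_on_component[OF assms])
  then show ?thesis by (intro smooth_on_vec) (simp add: matrix_vector_mult_def)
qed

lemma smooth_multiplier: "smooth_on UNIV (\<lambda>z. multiplier (fst z) (snd z))"
proof -
  have snd: "smooth_on UNIV (\<lambda>z :: (real^'n) \<times> (real^'n). snd z)"
    by (rule smooth_on_linear[OF bounded_linear_snd])
  have gram: "smooth_on UNIV (\<lambda>z :: (real^'n) \<times> (real^'n). gram (fst z) $ i $ j)" for i j
  proof (cases "i \<in> K \<and> j \<in> K")
    case True
    then show ?thesis
      by (simp add: gram_def smooth_on_inner[OF smooth_g_fst smooth_W_mult[OF smooth_g_fst]])
  next
    case False
    then have "gram x $ i $ j = (if i = j then 1 else 0)" for x by (auto simp: gram_def)
    then show ?thesis by (simp only: smooth_on_const)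
  qed
  have "smooth_on UNIV (\<lambda>z :: (real^'n) \<times> (real^'n). - 1 * (g i (fst z) \<bullet> (W *v snd z)))" if "i \<in> K" for i
    by (rule smooth_on_mult[OF smooth_on_const smooth_on_inner[OF smooth_g_fst[OF that] smooth_W_mult[OF snd]]])
  then have rhs: "smooth_on UNIV (\<lambda>z. gram_rhs (fst z) (snd z) $ i)" for i
    by (cases "i \<in> K") (simp_all add: gram_rhs_def smooth_on_const)
  have "smooth_on UNIV (\<lambda>z. det (\<chi> i j. if j = k then gram_rhs (fst z) (snd z) $ i
      else gram (fst z) $ i $ j) * inverse (det (gram (fst z))))" for k
  proof (rule smooth_on_mult)
    show "smooth_on UNIV (\<lambda>z. det (\<chi> i j. if j = k then gram_rhs (fst z) (snd z) $ i
      else gram (fst z) $ i $ j))"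
    proof (rule smooth_on_det)
      fix i j
      show "smooth_on UNIV (\<lambda>z. (\<chi> i j. if j = k then gram_rhs (fst z) (snd z) $ i
        else gram (fst z) $ i $ j) $ i $ j)"
        using gram[of i j] rhs[of i] by (cases "j = k") simp_all
    qed
    show "smooth_on UNIV (\<lambda>z :: (real^'n) \<times> (real^'n). inverse (det (gram (fst z))))"
      by (rule smooth_on_inverse[OF det_gram smooth_on_det[OF gram]])
  qed
  then show ?thesis
    by (intro smooth_on_vec) (simp add: multiplier_def divide_inverse)
qed

definition reduced_hamiltonian :: "(real^'n) \<times> (real^'n) \<Rightarrow> real" where
  "reduced_hamiltonian z = energy (fst z) (snd z) (multiplier (fst z) (snd z))"

lemma smooth_reduced_hamiltonian: "smooth_on UNIV reduced_hamiltonian"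
proof -
  have momentum: "smooth_on UNIV
      (\<lambda>z. snd z + (\<Sum>i\<in>K. multiplier (fst z) (snd z) $ i *\<^sub>R g i (fst z)))"
    by (rule smooth_on_add[OF smooth_on_linear[OF bounded_linear_snd]], rule smooth_on_sum,
        rule smooth_on_scaleR[OF smooth_on_component[OF smooth_multiplier] smooth_g_fst])
  show ?thesis
    unfolding reduced_hamiltonian_def energy_def velocity_def kinetic_momentum_def
    by (rule smooth_on_add[OF smooth_on_mult[OF smooth_on_const
          smooth_on_inner[OF momentum smooth_W_mult[OF momentum]]]
          smooth_on_compose_linear[OF bounded_linear_fst smooth_V]])
qed

lemma reduced_velocity_admissible:
  "i \<in> K \<Longrightarrow> g i x \<bullet> velocity x p (multiplier x p) = 0"
  using multiplier_iff by blast

text \<open>The derivative of the multipliers is paired with the numbers \<open>g\<^sub>i \<bullet> v\<close>, and these vanish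
identically on the graph of \<open>multiplier\<close>, so only the explicit dependence on position and momentum
remains.\<close>

lemma reduced_hamiltonian_has_derivative:
  assumes X: "(X has_derivative X') (at z)" and P: "(P has_derivative P') (at z)"
  shows "((\<lambda>z. reduced_hamiltonian (X z, P z)) has_derivative
    (\<lambda>d. P' d \<bullet> velocity (X z) (P z) (multiplier (X z) (P z))
       + X' d \<bullet> (constraint_force (multiplier (X z) (P z))
                   (velocity (X z) (P z) (multiplier (X z) (P z))) (X z) + grad V (X z)))) (at z)"
proof -
  obtain D where "((\<lambda>z. multiplier (fst z) (snd z)) has_derivative D) (at (X z, P z))"
    using smooth_on_UNIV_has_derivative[OF smooth_multiplier] by blast
  from has_derivative_compose[OF has_derivative_Pair[OF X P] this]
  have "((\<lambda>z. multiplier (X z) (P z)) has_derivative (\<lambda>d. D (X' d, P' d))) (at z)"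
    by simp
  from energy_has_derivative[OF X P this] show ?thesis
    unfolding reduced_hamiltonian_def by (simp add: reduced_velocity_admissible)
qed

lemma grad_reduced_hamiltonian_momentum:
  "grad (\<lambda>y. reduced_hamiltonian (x, y)) p = velocity x p (multiplier x p)"
  by (rule grad_eqI[OF reduced_hamiltonian_has_derivative[OF has_derivative_const has_derivative_ident]])
    simp

lemma grad_reduced_hamiltonian_position:
  "grad (\<lambda>y. reduced_hamiltonian (y, p)) x =
     constraint_force (multiplier x p) (velocity x p (multiplier x p)) x + grad V x"
  by (rule grad_eqI[OF reduced_hamiltonian_has_derivative[OF has_derivative_ident has_derivative_const]])
    simp

lemma gen_ham_system_multiplier_eq:
  assumes "a < b"
    and "gen_ham_system M V K g L h {a..b} (\<lambda>t. phase_point (q t) (p t) (lam t) (mu t))"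
    and "t \<in> {a..b}" "i \<in> K"
  shows "lam t $ i = multiplier (q t) (p t) $ i"
  using assms(2-) unfolding gen_ham_system_iff[OF assms(1)] multiplier_iff by blast

lemma canonical_system_iff:
  "canonical_system reduced_hamiltonian L h T q p mu \<longleftrightarrow>
     q differentiable_on T \<and> p differentiable_on T \<and> mu differentiable_on T \<and>
     (\<forall>t\<in>T. vector_derivative q (at t within T) = velocity (q t) (p t) (multiplier (q t) (p t)) \<and>
        vector_derivative p (at t within T) =
          - (constraint_force (multiplier (q t) (p t))
               (velocity (q t) (p t) (multiplier (q t) (p t))) (q t) + grad V (q t)
             + (\<Sum>i\<in>L. mu t $ i *\<^sub>R grad (h i) (q t))) \<and>
        (\<forall>i\<in>L. h i (q t) = 0))"
  unfolding canonical_system_def grad_reduced_hamiltonian_momentum grad_reduced_hamiltonian_position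
  by (simp add: diff_diff_eq)

lemma differentiable_on_multiplier:
  assumes "q differentiable_on T" "p differentiable_on T"
  shows "(\<lambda>t. multiplier (q t) (p t)) differentiable_on T"
  unfolding differentiable_on_def
proof
  fix t assume "t \<in> T"
  then obtain q' p' where "(q has_derivative q') (at t within T)" "(p has_derivative p') (at t within T)"
    using assms unfolding differentiable_on_def differentiable_def by blast
  from has_derivative_compose[OF has_derivative_Pair[OF this]
      smooth_on_UNIV_has_derivative[OF smooth_multiplier]]
  show "(\<lambda>t. multiplier (q t) (p t)) differentiable at t within T"
    by (auto intro: differentiableI)
qed

text \<open>A canonical solution is lifted by \<open>multiplier\<close>, which is differentiable along it because it is
smooth; conversely the constraints force every choice of multipliers to coincide with it on \<open>K\<close>,
and no other coordinate enters the equations.\<close>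

lemma canonical_system_iff_gen_ham_system:
  assumes "a < b"
  shows "canonical_system reduced_hamiltonian L h {a..b} q p mu \<longleftrightarrow>
    (\<exists>lam. gen_ham_system M V K g L h {a..b} (\<lambda>t. phase_point (q t) (p t) (lam t) (mu t)))"
proof
  assume can: "canonical_system reduced_hamiltonian L h {a..b} q p mu"
  then have "(\<lambda>t. multiplier (q t) (p t)) differentiable_on {a..b}"
    by (intro differentiable_on_multiplier) (simp_all add: canonical_system_def)
  with can have "gen_ham_system M V K g L h {a..b}
      (\<lambda>t. phase_point (q t) (p t) (multiplier (q t) (p t)) (mu t))"
    unfolding canonical_system_iff gen_ham_system_iff[OF assms]
    using reduced_velocity_admissible by blast
  then show "\<exists>lam. gen_ham_system M V K g L h {a..b} (\<lambda>t. phase_point (q t) (p t) (lam t) (mu t))"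
    by (rule exI[of _ "\<lambda>t. multiplier (q t) (p t)"])
next
  assume "\<exists>lam. gen_ham_system M V K g L h {a..b} (\<lambda>t. phase_point (q t) (p t) (lam t) (mu t))"
  then obtain lam
    where ham: "gen_ham_system M V K g L h {a..b} (\<lambda>t. phase_point (q t) (p t) (lam t) (mu t))"
    by blast
  note lam = gen_ham_system_multiplier_eq[OF assms ham]
  have "velocity (q t) (p t) (lam t) = velocity (q t) (p t) (multiplier (q t) (p t))"
    "constraint_force (lam t) v (q t) = constraint_force (multiplier (q t) (p t)) v (q t)"
    if "t \<in> {a..b}" for t v
    using velocity_cong[OF lam[OF that]] constraint_force_cong[OF lam[OF that]] by blast+
  with ham show "canonical_system reduced_hamiltonian L h {a..b} q p mu"
    unfolding canonical_system_iff gen_ham_system_iff[OF assms]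
    by (simp del: minus_add_distrib atLeastAtMost_iff)
qed

end

section \<open>Equivalence of the three systems\<close>

theorem proposition6:
  fixes M :: "real^'n^'n"
    and V :: "real^'n \<Rightarrow> real"
    and K :: "'k::finite set" and g :: "'k \<Rightarrow> real^'n \<Rightarrow> real^'n"
    and L :: "'l::finite set" and h :: "'l \<Rightarrow> real^'n \<Rightarrow> real"
    and t0 t1 :: real
  assumes "transpose M = M" and "invertible M"
    and "smooth_on UNIV V"
    and "\<forall>i\<in>K. smooth_on UNIV (g i)"
    and "\<forall>i\<in>L. h i differentiable_on UNIV"
    and "t0 < t1"
  shows
    "(\<forall>q0 q1 q. smooth_extremal M V K g L h t0 t1 q0 q1 q \<longrightarrow>
        (\<exists>lam mu. euler_lagrange M V K g L h {t0..t1} q lam mu \<and>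
           gen_ham_system M V K g L h {t0..t1}
             (\<lambda>t. phase_point (q t) (momentum M K g {t0..t1} q lam t) (lam t) (mu t))))
     \<and>
     (\<forall>q p lam mu.
        gen_ham_system M V K g L h {t0..t1} (\<lambda>t. phase_point (q t) (p t) (lam t) (mu t)) \<longleftrightarrow>
        euler_lagrange M V K g L h {t0..t1} q lam mu \<and>
        (\<forall>t\<in>{t0..t1}. p t = momentum M K g {t0..t1} q lam t))
     \<and>
     ((\<forall>x. lin_indep_family K (\<lambda>i. g i x)) \<and>
      (\<forall>x. nondegenerate_on (matrix_inv M) (span ((\<lambda>i. g i x) ` K))) \<longrightarrow>
      (\<exists>Ht. smooth_on UNIV Ht \<and>
        (\<forall>a b q p mu. a < b \<longrightarrow>
           (canonical_system Ht L h {a..b} q p mu \<longleftrightarrow>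
              (\<exists>lam. gen_ham_system M V K g L h {a..b}
                       (\<lambda>t. phase_point (q t) (p t) (lam t) (mu t)))) \<and>
           (\<forall>lam lam'.
              gen_ham_system M V K g L h {a..b}
                (\<lambda>t. phase_point (q t) (p t) (lam t) (mu t)) \<and>
              gen_ham_system M V K g L h {a..b}
                (\<lambda>t. phase_point (q t) (p t) (lam' t) (mu t)) \<longrightarrow>
              (\<forall>t\<in>{a..b}. \<forall>i\<in>K. lam t $ i = lam' t $ i)))))"
proof -
  interpret constrained_mechanics M V K g L h
    using assms by unfold_locales auto
  have regular: "regular_constrained_mechanics M V K g L h"
    if "\<forall>x. lin_indep_family K (\<lambda>i. g i x)"
      and "\<forall>x. nondegenerate_on (matrix_inv M) (span ((\<lambda>i. g i x) ` K))"
    using that by unfold_locales (simp add: det_gram_nonzero)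
  note equivalence = gen_ham_system_iff_euler_lagrange[OF \<open>t0 < t1\<close>]
  show ?thesis
  proof (intro conjI impI allI; (elim conjE)?)
    fix q0 q1 q
    assume "smooth_extremal M V K g L h t0 t1 q0 q1 q"
    then obtain lam mu where "euler_lagrange M V K g L h {t0..t1} q lam mu"
      unfolding smooth_extremal_def by blast
    then show "\<exists>lam mu. euler_lagrange M V K g L h {t0..t1} q lam mu \<and>
        gen_ham_system M V K g L h {t0..t1}
          (\<lambda>t. phase_point (q t) (momentum M K g {t0..t1} q lam t) (lam t) (mu t))"
      unfolding equivalence by blast
  next
    fix q p lam mu
    show "gen_ham_system M V K g L h {t0..t1} (\<lambda>t. phase_point (q t) (p t) (lam t) (mu t)) \<longleftrightarrow>
        euler_lagrange M V K g L h {t0..t1} q lam mu \<and>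
        (\<forall>t\<in>{t0..t1}. p t = momentum M K g {t0..t1} q lam t)"
      by (rule equivalence)
  next
    assume "\<forall>x. lin_indep_family K (\<lambda>i. g i x)"
      and "\<forall>x. nondegenerate_on (matrix_inv M) (span ((\<lambda>i. g i x) ` K))"
    then interpret regular_constrained_mechanics M V K g L h
      by (rule regular)
    show "\<exists>Ht. smooth_on UNIV Ht \<and>
        (\<forall>a b q p mu. a < b \<longrightarrow>
           (canonical_system Ht L h {a..b} q p mu \<longleftrightarrow>
              (\<exists>lam. gen_ham_system M V K g L h {a..b}
                       (\<lambda>t. phase_point (q t) (p t) (lam t) (mu t)))) \<and>
           (\<forall>lam lam'.
              gen_ham_system M V K g L h {a..b}
                (\<lambda>t. phase_point (q t) (p t) (lam t) (mu t)) \<and>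
              gen_ham_system M V K g L h {a..b}
                (\<lambda>t. phase_point (q t) (p t) (lam' t) (mu t)) \<longrightarrow>
              (\<forall>t\<in>{a..b}. \<forall>i\<in>K. lam t $ i = lam' t $ i)))"
    proof (intro exI[of _ reduced_hamiltonian] conjI allI impI ballI; (elim conjE)?)
      show "smooth_on UNIV reduced_hamiltonian"
        by (rule smooth_reduced_hamiltonian)
    next
      fix a b :: real and q p mu
      assume "a < b"
      then show "canonical_system reduced_hamiltonian L h {a..b} q p mu \<longleftrightarrow>
          (\<exists>lam. gen_ham_system M V K g L h {a..b}
                   (\<lambda>t. phase_point (q t) (p t) (lam t) (mu t)))"
        by (rule canonical_system_iff_gen_ham_system)
    next
      fix a b :: real and q p mu lam lam' t i
      assume "a < b" "t \<in> {a..b}" "i \<in> K"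
        and "gen_ham_system M V K g L h {a..b} (\<lambda>t. phase_point (q t) (p t) (lam t) (mu t))"
        and "gen_ham_system M V K g L h {a..b} (\<lambda>t. phase_point (q t) (p t) (lam' t) (mu t))"
      then show "lam t $ i = lam' t $ i"
        by (simp only: gen_ham_system_multiplier_eq)
    qed
  qed
qed

end
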